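(* Let $\beta_L\approx 0.158374$ be the unique root in $(0,\infty)$ of $$\frac{3}{\Gamma(-\frac12)}\sum_{j=0}^\infty\frac{\Gamma(-\frac12+j)}{j!\,(1+j\beta)}-1=0.$$ Let $\beta\ge\beta_L$, let $f\in\mathcal{A}$, and let $$\mathcal{G}(z)=1-\frac{zf'(z)}{f(z)}+\frac{zf''(z)}{f'(z)},\quad z\in\mathbb{D}.$$ If $$\left(1+\beta\,\mathcal{G}(z)\right)\frac{zf'(z)}{f(z)}\prec\sqrt{1+z},$$ then $f\in\mathcal{S}^*_{Ne}$.
   Context: $\mathbb{D}=\{z\in\mathbb{C}:|z|<1\}$. $\mathcal{A}$ is the class of analytic functions $f$ on $\mathbb{D}$ with $f(0)=0$ and $f'(0)=1$. For $f$ analytic on $\mathbb{D}$ and $g$ univalent (analytic and injective) on $\mathbb{D}$, $f\prec g$ means $f(0)=g(0)$ and $f(\mathbb{D})\subset g(\mathbb{D})$. $\mathcal{S}^*_{Ne}$ is the class of all $f\in\mathcal{A}$ with $\frac{zf'(z)}{f(z)}\prec\varphi_{Ne}(z)$, where $\varphi_{Ne}(z)=1+z-z^3/3$ (univalent on $\mathbb{D}$). The square root is the principal branch. The function on the left of a subordination is understood to be analytic on $\mathbb{D}$ (removable singularities being filled in; e.g. $zf'(z)/f(z)$ takes the value $1$ at $z=0$). $\Gamma$ is the (analytically continued) gamma function, so $\Gamma(-\tfrac12)=-2\sqrt{\pi}$. *)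

theory Defs
  imports "HOL-Complex_Analysis.Complex_Analysis"
begin

abbreviation unit_disc :: "complex set" where
  "unit_disc \<equiv> ball 0 1"

definition class_A :: "(complex \<Rightarrow> complex) set" where
  "class_A = {f. f analytic_on unit_disc \<and> f 0 = 0 \<and> deriv f 0 = 1}"

definition univalent :: "(complex \<Rightarrow> complex) \<Rightarrow> bool" where
  "univalent g \<longleftrightarrow> g analytic_on unit_disc \<and> inj_on g unit_disc"

definition subordinate :: "(complex \<Rightarrow> complex) \<Rightarrow> (complex \<Rightarrow> complex) \<Rightarrow> bool" where
  "subordinate h g \<longleftrightarrow> h analytic_on unit_disc \<and> univalent g \<and>
     h 0 = g 0 \<and> h ` unit_disc \<subseteq> g ` unit_disc"

text \<open>
  Quotients such as z f'(z) / f(z) are undefined at the origin and at the zeros of their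
  denominators. There the HOL convention x / 0 = 0 supplies a meaningless value, which
  \<^const>\<open>remove_sings\<close> replaces by the limit. At a pole, \<^const>\<open>remove_sings\<close> returns 0 and
  the result is not analytic there, so analyticity of the left-hand side in
  \<open>subordinate\<close> says that all its singularities in the disc are removable.
\<close>

definition phi_Ne :: "complex \<Rightarrow> complex" where
  "phi_Ne z = 1 + z - z ^ 3 / 3"

definition S_Ne :: "(complex \<Rightarrow> complex) set" where
  "S_Ne = {f \<in> class_A. subordinate (remove_sings (\<lambda>z. z * deriv f z / f z)) phi_Ne}"

definition G_fun :: "(complex \<Rightarrow> complex) \<Rightarrow> complex \<Rightarrow> complex" where
  "G_fun f z = 1 - z * deriv f z / f z + z * deriv (deriv f) z / deriv f z"

definition beta_equation :: "real \<Rightarrow> bool" where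
  "beta_equation \<beta> \<longleftrightarrow>
     3 / Gamma (- 1 / 2) * (\<Sum>j. Gamma (- 1 / 2 + real j) / (fact j * (1 + real j * \<beta>))) - 1 = 0"

definition beta_L :: real where
  "beta_L = (THE \<beta>. 0 < \<beta> \<and> beta_equation \<beta>)"

end

theory Submission
  imports Defs
begin

text \<open>
  Put \<open>p = z f' / f\<close>. Logarithmic differentiation gives \<open>z p' / p = G\<close>, so the function on the left of
  the subordination is \<open>h = p + \<beta> z p'\<close>. Hence \<open>p\<close> is the average of \<open>h(z t\<^sup>\<beta>)\<close> over
  \<open>0 \<le> t \<le> 1\<close> (\<open>class_A_log_derivative_eq_average\<close>), also at possible zeros of \<open>f\<close> and
  \<open>f'\<close>, by analytic continuation from the origin.

  As \<open>h\<close> is subordinate to \<open>(1 + z)\<^sup>1\<^sup>/\<^sup>2\<close>, it is \<open>(1 + w)\<^sup>1\<^sup>/\<^sup>2\<close> with \<open>|w(z)| \<le> |z|\<close>, and its real part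
  at \<open>z\<close> is at least \<open>(1 - |z|)\<^sup>1\<^sup>/\<^sup>2\<close>. Averaging, the real part of \<open>p\<close> exceeds the integral
  \<open>I(\<beta>)\<close> of \<open>(1 - t\<^sup>\<beta>)\<^sup>1\<^sup>/\<^sup>2\<close> over the unit interval, while the crude bounds \<open>Re p \<le> 3/2\<close> and
  \<open>|Im p| \<le> 1\<close> follow from the same bounds for \<open>h\<close> (\<open>subordinate_csqrt_average_bounds\<close>).

  Expanding the root in its binomial series shows that the equation for \<open>\<beta>\<close> reads \<open>I(\<beta>) = 1/3\<close>
  (\<open>beta_equation_iff\<close>). Since \<open>I\<close> is continuous and strictly increasing and passes the value \<open>1/3\<close>
  between \<open>1/15\<close> and \<open>1\<close>, the root exists and is unique, and \<open>I(\<beta>) \<ge> 1/3\<close> exactly from the root on. For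
  such \<open>\<beta>\<close> the values of \<open>p\<close> lie in the rectangle \<open>|Re p - 1| < 2/3\<close>, \<open>|Im p| \<le> 1\<close>. The number \<open>1/3\<close>
  is the left cusp of the nephroid, and this rectangle is contained in the nephroid domain
  (\<open>rectangle_subset_phi_Ne\<close>).
\<close>

section \<open>The nephroid domain\<close>

lemma phi_Ne_holomorphic: "phi_Ne holomorphic_on S"
  unfolding phi_Ne_def by (intro holomorphic_intros) auto

text \<open>
  If \<open>\<phi>(z) = \<phi>(w)\<close> with \<open>z \<noteq> w\<close>, then cancelling \<open>z - w\<close> leaves \<open>z\<^sup>2 + z w + w\<^sup>2 = 3\<close>,
  where each of the three terms has modulus less than \<open>1\<close>.
\<close>

lemma univalent_phi_Ne: "univalent phi_Ne"
proof -
  have "inj_on phi_Ne unit_disc"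
  proof (rule inj_onI)
    fix z w assume zw: "z \<in> unit_disc" "w \<in> unit_disc" and eq: "phi_Ne z = phi_Ne w"
    have "(z - w) * (3 - (z^2 + z*w + w^2)) = 0"
      using eq unfolding phi_Ne_def by (simp add: divide_simps) algebra
    moreover have "z^2 + z*w + w^2 \<noteq> 3"
    proof
      assume *: "z^2 + z*w + w^2 = 3"
      have 1: "norm z < 1" "norm w < 1" using zw by auto
      have "norm (z^2 + z*w + w^2) \<le> norm (z^2) + norm (z*w) + norm (w^2)"
        by (intro norm_triangle_le add_right_mono norm_triangle_ineq) simp
      moreover have "norm (z^2) < 1" "norm (w^2) < 1"
        using 1 by (auto simp: norm_power power_less_one_iff)
      moreover have "norm (z*w) \<le> 1" using 1 by (simp add: norm_mult mult_le_one)
      ultimately show False using * by simp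
    qed
    ultimately show "z = w" by auto
  qed
  then show ?thesis
    unfolding univalent_def
    by (auto simp: analytic_on_open intro: phi_Ne_holomorphic)
qed

text \<open>
  The implicit equation of the nephroid. With \<open>z = x + i y\<close> and \<open>x\<^sup>2 + y\<^sup>2 = 1\<close> one has
  \<open>v = 4/3 y\<^sup>3\<close> and \<open>u\<^sup>2 + v\<^sup>2 - 4/9 = 4/3 y\<^sup>2\<close>, and both sides equal \<open>64/27 y\<^sup>6\<close>.
\<close>

lemma phi_Ne_on_unit_circle:
  assumes "norm z = 1"
  defines "u \<equiv> Re (phi_Ne z) - 1" and "v \<equiv> Im (phi_Ne z)"
  shows "(u^2 + v^2 - 4/9)^3 = 4/3 * v^2"
proof -
  define x where "x = Re z"
  define y where "y = Im z"
  have z: "z = Complex x y" by (simp add: x_def y_def)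
  have xy: "x^2 = 1 - y^2"
    using assms(1) unfolding x_def y_def by (simp add: norm_complex_def)
  have Re3: "Re (z^3) = x * (x^2 - 3*y^2)" and Im3: "Im (z^3) = y * (3*x^2 - y^2)"
    by (simp_all add: z power3_eq_cube power2_eq_square algebra_simps)
  have "u = x * (2/3 + 4/3 * y^2)"
    unfolding u_def phi_Ne_def by (simp add: Re3 xy x_def[symmetric] field_simps)
  moreover have v: "v = 4/3 * y^3"
    unfolding v_def phi_Ne_def
    by (simp add: Im3 xy y_def[symmetric]) (simp add: field_simps power3_eq_cube power2_eq_square)
  ultimately have "u^2 + v^2 - 4/9 = 4/3 * y^2"
    by (simp add: power_mult_distrib xy) (simp add: field_simps power2_eq_square power3_eq_cube)
  moreover have "(4/3 * y^2)^3 = 4/3 * v^2" by (simp add: v power_mult_distrib power_divide)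
  ultimately show ?thesis by (simp only:)
qed

text \<open>
  Write \<open>w = 1 + u + i v\<close>. The rectangle lies between the vertical lines through the two cusps
  \<open>1/3\<close> and \<open>5/3\<close> of the nephroid. It is connected and
  contains \<open>\<phi>(0) = 1\<close>, so if it left the open set \<open>\<phi>(D)\<close> it would meet the boundary, which is
  part of the image of the circle. But in the rectangle the implicit equation fails: there
  \<open>u\<^sup>2 < 4/9\<close> gives \<open>(u\<^sup>2 + v\<^sup>2 - 4/9)\<^sup>3 < v\<^sup>6 \<le> 4/3 v\<^sup>2\<close>.
\<close>

lemma rectangle_subset_phi_Ne:
  assumes "\<bar>Re w - 1\<bar> < 2/3" "\<bar>Im w\<bar> \<le> 1"
  shows "w \<in> phi_Ne ` unit_disc"
proof (rule ccontr)
  assume w: "w \<notin> phi_Ne ` unit_disc"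
  define R where "R = {w::complex. \<bar>Re w - 1\<bar> < 2/3 \<and> \<bar>Im w\<bar> \<le> 1}"
  have R_eq: "R = {w. Re w > 1/3} \<inter> {w. Re w < 5/3} \<inter> {w. Im w \<ge> -1} \<inter> {w. Im w \<le> 1}"
    unfolding R_def abs_less_iff abs_le_iff by auto
  have "connected R"
    unfolding R_eq
    by (intro convex_connected convex_Int convex_halfspace_Re_gt convex_halfspace_Re_lt
        convex_halfspace_Im_ge convex_halfspace_Im_le)
  moreover have "1 \<in> R \<inter> phi_Ne ` unit_disc"
    by (auto simp: R_def phi_Ne_def image_iff intro!: bexI[of _ 0])
  moreover have "w \<in> R - phi_Ne ` unit_disc" using w assms by (auto simp: R_def)
  ultimately obtain c where c: "c \<in> R" "c \<in> frontier (phi_Ne ` unit_disc)"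
    using connected_Int_frontier[of R "phi_Ne ` unit_disc"] by blast
  have "open (phi_Ne ` unit_disc)"
    using univalent_phi_Ne open_mapping_thm3[of phi_Ne unit_disc]
    by (auto simp: univalent_def phi_Ne_holomorphic)
  then have notin: "c \<notin> phi_Ne ` unit_disc"
    using c(2) by (simp add: frontier_def interior_open)
  have "compact (phi_Ne ` cball 0 1)"
    by (intro compact_continuous_image holomorphic_on_imp_continuous_on phi_Ne_holomorphic) simp
  then have "closure (phi_Ne ` unit_disc) \<subseteq> phi_Ne ` cball 0 1"
    by (intro closure_minimal compact_imp_closed image_mono) auto
  then obtain z where z: "norm z \<le> 1" "c = phi_Ne z"
    using c(2) by (auto simp: frontier_def)
  with notin have "norm z = 1" by (cases "norm z = 1") auto
  define u where "u = Re c - 1"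
  define v where "v = Im c"
  have eq: "(u^2 + v^2 - 4/9)^3 = 4/3 * v^2"
    using phi_Ne_on_unit_circle[OF \<open>norm z = 1\<close>] z(2) by (simp add: u_def v_def)
  have "\<bar>u\<bar> < 2/3" "\<bar>v\<bar> \<le> 1" using c(1) by (auto simp: R_def u_def v_def)
  then have "u^2 < (2/3)^2" "v^2 \<le> 1"
    by (auto simp: abs_square_le_1 power2_strict_mono intro!: power2_strict_mono)
  define a where "a = u^2 + v^2 - 4/9"
  have "a < v^2" using \<open>u^2 < (2/3)^2\<close> by (simp add: a_def power_divide)
  then have "a^3 < (v^2)^3"
    using power_strict_mono[of a "v^2" 3] zero_le_odd_power[of 3 a]
      zero_le_power[of "v^2" 3] by (smt (verit) odd_numeral zero_le_power2 zero_less_numeral)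
  also have "(v^2)^3 \<le> v^2 * 1"
    using \<open>v^2 \<le> 1\<close> power_decreasing[of 1 3 "v^2"] by simp
  also have "\<dots> \<le> 4/3 * v^2" by simp
  finally show False using eq by (simp add: a_def)
qed

section \<open>The mean of the square root and its binomial series\<close>

text \<open>
  This is the boundary value at \<open>-1\<close> of the solution \<open>q\<close> of \<open>q + \<beta> z q' = (1 + z)\<^sup>1\<^sup>/\<^sup>2\<close> that is analytic
  in the disc.
\<close>

definition sqrt_mean :: "real \<Rightarrow> real" where
  "sqrt_mean \<beta> = integral {0..1} (\<lambda>t. sqrt (1 - t powr \<beta>))"

lemma continuous_on_powr_unit:
  fixes \<beta> :: real
  assumes "\<beta> > 0"
  shows "continuous_on {0..1} (\<lambda>t. t powr \<beta>)"
  using assms by (intro continuous_on_powr') auto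

lemma powr_unit_strict:
  fixes t \<beta> :: real
  assumes "0 < t" "t < 1" "\<beta> > 0"
  shows "0 < t powr \<beta>" "t powr \<beta> < 1"
  using assms powr_less_mono2[of \<beta> t 1] by simp_all

lemma powr_unit:
  fixes t \<beta> :: real
  assumes "0 \<le> t" "t \<le> 1" "\<beta> > 0"
  shows "0 \<le> t powr \<beta>" "t powr \<beta> \<le> 1"
  using assms by (simp_all add: powr_le1)

lemma sqrt_mean_strict_mono:
  assumes "0 < a" "a < b"
  shows "sqrt_mean a < sqrt_mean b"
  unfolding sqrt_mean_def
proof (rule integral_less_real)
  fix t :: real assume "t \<in> {0<..<1}"
  then show "sqrt (1 - t powr a) < sqrt (1 - t powr b)"
    using assms by (auto intro: powr_less_mono')
qed (use assms in \<open>auto intro!: continuous_intros continuous_on_powr_unit\<close>)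

lemma continuous_on_sqrt_mean: "continuous_on {0<..} sqrt_mean"
proof -
  have "continuous_on ({0<..} \<times> cbox 0 1) (\<lambda>(\<beta>::real, t::real). sqrt (1 - t powr \<beta>))"
    unfolding case_prod_unfold
    by (intro continuous_intros continuous_on_powr') auto
  from integral_continuous_on_param[OF this] show ?thesis
    by (simp add: sqrt_mean_def[abs_def])
qed

text \<open>
  The binomial series of \<open>(1 - x)\<^sup>1\<^sup>/\<^sup>2\<close> has constant term \<open>1\<close> and all other coefficients \<open>\<le> 0\<close>. So for
  \<open>0 \<le> x < 1\<close> its partial sums decrease from \<open>1\<close> to a nonnegative limit; the resulting bound is uniform
  in \<open>x\<close> up to the boundary point \<open>1\<close> and dominates the termwise integration below.
\<close>

lemma sqrt_coeff_nonpos: "pochhammer (- 1/2 :: real) (Suc j) / fact (Suc j) \<le> 0"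
proof -
  have "pochhammer (- 1/2 :: real) (Suc j) = - (1/2) * pochhammer (1/2) j"
    by (subst pochhammer_rec) simp
  then show ?thesis
    by (simp add: divide_nonpos_pos pochhammer_nonneg del: fact_Suc)
qed

lemma sqrt_binomial_sums:
  fixes x :: real
  assumes "0 \<le> x" "x < 1"
  shows "(\<lambda>j. pochhammer (- 1/2) j / fact j * x ^ j) sums sqrt (1 - x)"
proof -
  have "(\<lambda>j. ((1/2) gchoose j) * (-x) ^ j) sums (1 + (-x)) powr (1/2)"
    using assms by (intro gen_binomial_real) auto
  moreover have "((1/2) gchoose j) * (-x) ^ j = pochhammer (- 1/2) j / fact j * x ^ j" for j
    unfolding gbinomial_pochhammer power_minus[of x j] by simp
  ultimately show ?thesis using assms by (simp add: powr_half_sqrt)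
qed

lemma sqrt_binomial_partial_sum_bound:
  fixes x :: real
  assumes "0 \<le> x" "x < 1"
  shows "\<bar>\<Sum>j<n. pochhammer (- 1/2) j / fact j * x ^ j\<bar> \<le> 1"
proof (cases n)
  case (Suc m)
  define S where "S n = (\<Sum>j<Suc n. pochhammer (- 1/2) j / fact j * x ^ j)" for n
  have dec: "decseq S"
  proof (rule decseq_SucI)
    fix n
    have "pochhammer (- 1/2) (Suc n) / fact (Suc n) * x ^ Suc n \<le> 0"
      using sqrt_coeff_nonpos[of n] assms by (intro mult_nonpos_nonneg) auto
    then show "S (Suc n) \<le> S n" unfolding S_def by (subst (2) sum.lessThan_Suc) simp
  qed
  have "S \<longlonglongrightarrow> sqrt (1 - x)"
    using sqrt_binomial_sums[OF assms] unfolding S_def sums_def by (rule LIMSEQ_Suc)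
  then have "sqrt (1 - x) \<le> S m" using decseq_ge[OF dec] by blast
  then have "0 \<le> S m" using assms order_trans[of 0 "sqrt (1 - x)"] by simp
  moreover have "S m \<le> S 0" using dec by (auto simp: decseq_def)
  moreover have "S 0 = 1" by (simp add: S_def)
  ultimately show ?thesis unfolding Suc S_def[symmetric] by simp
qed auto

text \<open>
  Substitute \<open>x = t\<^sup>\<beta>\<close> in the binomial series and integrate termwise. Working on the open interval avoids
  \<open>t = 1\<close>, where convergence of the series would need a separate argument, and \<open>t = 0\<close>, where \<open>0 powr 0 = 0\<close> but
  \<open>0 ^ 0 = 1\<close>.
\<close>

lemma sqrt_mean_sums:
  assumes "\<beta> > 0"
  shows "(\<lambda>j. pochhammer (- 1/2) j / fact j / (1 + real j * \<beta>)) sums sqrt_mean \<beta>"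
proof -
  define S where "S n t = (\<Sum>j<n. pochhammer (- 1/2) j / fact j * (t powr \<beta>) ^ j)" for n and t :: real
  have S_int: "(S n has_integral (\<Sum>j<n. pochhammer (- 1/2) j / fact j / (1 + real j * \<beta>))) {0<..<1}" for n
    unfolding S_def
  proof (rule has_integral_sum)
    fix j
    have "((\<lambda>t. t powr (real j * \<beta>)) has_integral (1 / (1 + real j * \<beta>))) {0..1}"
      using has_integral_powr_from_0[of "real j * \<beta>" 1] assms
      by (simp add: add.commute less_le_trans[of "-1" 0])
    then have "((\<lambda>t. t powr (real j * \<beta>)) has_integral (1 / (1 + real j * \<beta>))) {0<..<1}"
      by (simp add: has_integral_Icc_iff_Ioo)
    then have "((\<lambda>t. (t powr \<beta>) ^ j) has_integral (1 / (1 + real j * \<beta>))) {0<..<1}"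
      by (rule has_integral_eq[rotated]) (auto simp: powr_power mult.commute)
    from has_integral_mult_right[OF this, of "pochhammer (- 1/2) j / fact j"]
    show "((\<lambda>t. pochhammer (- 1/2) j / fact j * (t powr \<beta>) ^ j) has_integral
        pochhammer (- 1/2) j / fact j / (1 + real j * \<beta>)) {0<..<1}" by simp
  qed simp
  have "(\<lambda>n. integral {0<..<1} (S n)) \<longlonglongrightarrow> integral {0<..<1} (\<lambda>t. sqrt (1 - t powr \<beta>))"
  proof (rule dominated_convergence(2))
    show "S n integrable_on {0<..<1}" for n using S_int by blast
    show "(\<lambda>t::real. 1::real) integrable_on {0<..<1}"
      by (simp add: integrable_on_Icc_iff_Ioo[symmetric] integrable_const_ivl)
    fix t :: real assume "t \<in> {0<..<1}"
    then have t: "0 \<le> t powr \<beta>" "t powr \<beta> < 1" using assms powr_unit_strict[of t \<beta>] by auto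
    show "norm (S n t) \<le> 1" for n
      using sqrt_binomial_partial_sum_bound[OF t] by (simp add: S_def)
    show "(\<lambda>n. S n t) \<longlonglongrightarrow> sqrt (1 - t powr \<beta>)"
      using sqrt_binomial_sums[OF t] by (simp add: S_def sums_def)
  qed
  moreover have "integral {0<..<1} (S n) = (\<Sum>j<n. pochhammer (- 1/2) j / fact j / (1 + real j * \<beta>))" for n
    using S_int by blast
  ultimately show ?thesis
    by (simp add: sums_def sqrt_mean_def integral_open_interval_real)
qed

text \<open>
  Since \<open>\<Gamma>(-1/2 + j) = \<Gamma>(-1/2) (-1/2)\<^sub>j\<close>, the series in the equation for \<open>\<beta>\<close> is \<open>\<Gamma>(-1/2)\<close> times the
  binomial series of the mean.
\<close>

lemma beta_equation_iff:
  assumes "\<beta> > 0"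
  shows "beta_equation \<beta> \<longleftrightarrow> sqrt_mean \<beta> = 1/3"
proof -
  have half: "(- 1/2 :: real) \<notin> \<int>\<^sub>\<le>\<^sub>0"
  proof
    assume "(- 1/2 :: real) \<in> \<int>\<^sub>\<le>\<^sub>0"
    then obtain n where "(- 1/2 :: real) = of_int n" by (elim nonpos_Ints_cases)
    then have "2 * real_of_int n = -1" by simp
    then have "2 * n = -1" by linarith
    then show False by presburger
  qed
  then have nz: "Gamma (- 1/2 :: real) \<noteq> 0" by (simp add: Gamma_eq_zero_iff)
  have "(\<lambda>j. Gamma (- 1/2) * (pochhammer (- 1/2) j / fact j / (1 + real j * \<beta>)))
      sums (Gamma (- 1/2) * sqrt_mean \<beta>)"
    by (intro sums_mult sqrt_mean_sums assms)
  moreover have "Gamma (- 1/2) * (pochhammer (- 1/2) j / fact j / (1 + real j * \<beta>)) =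
      Gamma (- 1/2 + real j) / (fact j * (1 + real j * \<beta>))" for j
    unfolding pochhammer_Gamma[OF half] using nz by (simp add: mult.commute)
  ultimately have "(\<lambda>j. Gamma (- 1/2 + real j) / (fact j * (1 + real j * \<beta>)))
      sums (Gamma (- 1/2) * sqrt_mean \<beta>)"
    by (simp only:)
  then have "(\<Sum>j. Gamma (- 1/2 + real j) / (fact j * (1 + real j * \<beta>)))
      = Gamma (- 1/2) * sqrt_mean \<beta>"
    by (rule sums_unique[symmetric])
  then show ?thesis using nz by (simp add: beta_equation_def mult.commute)
qed

text \<open>
  Jensen's inequality for the square root: the mean of \<open>1 - t\<^sup>\<beta>\<close> is \<open>\<beta> / (1 + \<beta>)\<close>, which is \<open>1/16\<close> for
  \<open>\<beta> = 1/15\<close>. The linear function below is the tangent to the square root at \<open>1/16\<close>.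
\<close>

lemma sqrt_mean_small: "sqrt_mean (1/15) \<le> 1/4"
proof -
  have 1: "((\<lambda>t::real. t powr (1/15)) has_integral 15/16) {0..1}"
    using has_integral_powr_from_0[of "1/15" 1] by simp
  have 2: "((\<lambda>t::real. 1::real) has_integral 1) {0..1}"
    using has_integral_const_real[of "1::real" 0 1] by simp
  have "((\<lambda>t::real. 2 * (1 - t powr (1/15)) + 1/8) has_integral (2 * (1 - 15/16) + 1/8)) {0..1}"
    using has_integral_add[OF has_integral_mult_right[OF has_integral_diff[OF 2 1], of 2]
        has_integral_mult_right[OF 2, of "1/8"]] by simp
  moreover have "(\<lambda>t::real. sqrt (1 - t powr (1/15))) integrable_on {0..1}"
    by (intro integrable_continuous_interval continuous_intros continuous_on_powr_unit) simp
  moreover have "sqrt (1 - t powr (1/15)) \<le> 2 * (1 - t powr (1/15)) + 1/8" if "t \<in> {0..1}" for t :: real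
  proof -
    define s where "s = sqrt (1 - t powr (1/15))"
    have "s^2 = 1 - t powr (1/15)" using that powr_unit[of t "1/15"] by (simp add: s_def)
    moreover have "0 \<le> (4 * s - 1)^2" by simp
    ultimately show ?thesis unfolding s_def[symmetric] by (simp add: power2_eq_square algebra_simps)
  qed
  ultimately have "sqrt_mean (1/15) \<le> 2 * (1 - 15/16) + 1/8"
    unfolding sqrt_mean_def by (meson has_integral_le integrable_integral)
  then show ?thesis by simp
qed

lemma sqrt_mean_one: "sqrt_mean 1 \<ge> 1/2"
proof -
  have 1: "((\<lambda>t::real. t powr 1) has_integral 1/2) {0..1}"
    using has_integral_powr_from_0[of "1" 1] by simp
  have 2: "((\<lambda>t::real. 1::real) has_integral 1) {0..1}"
    using has_integral_const_real[of "1::real" 0 1] by simp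
  have "((\<lambda>t::real. 1 - t powr 1) has_integral (1 - 1/2)) {0..1}"
    by (rule has_integral_diff[OF 2 1])
  moreover have "(\<lambda>t::real. sqrt (1 - t powr 1)) integrable_on {0..1}"
    by (intro integrable_continuous_interval continuous_intros continuous_on_powr_unit) simp
  moreover have "1 - t powr 1 \<le> sqrt (1 - t powr 1)" if "t \<in> {0..1}" for t :: real
  proof -
    define s where "s = sqrt (1 - t powr 1)"
    have s: "0 \<le> s" "s \<le> 1" "s^2 = 1 - t powr 1" using that by (auto simp: s_def)
    have "s^2 \<le> s" using s(1,2) by (simp add: power2_eq_square mult_left_le)
    then show ?thesis using s(3) by (simp add: s_def)
  qed
  ultimately have "1 - 1/2 \<le> sqrt_mean 1"
    unfolding sqrt_mean_def by (meson has_integral_le integrable_integral)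
  then show ?thesis by simp
qed

lemma beta_equation_ex1: "\<exists>!\<beta>::real. 0 < \<beta> \<and> beta_equation \<beta>"
proof -
  have "\<exists>\<beta>\<ge>1/15. \<beta> \<le> 1 \<and> sqrt_mean \<beta> = 1/3"
    using sqrt_mean_small sqrt_mean_one
    by (intro IVT' continuous_on_subset[OF continuous_on_sqrt_mean]) auto
  then obtain \<beta> where b: "\<beta> \<ge> 1/15" "sqrt_mean \<beta> = 1/3" by blast
  show ?thesis
  proof (rule ex1I[of _ \<beta>])
    show "0 < \<beta> \<and> beta_equation \<beta>" using b by (simp add: beta_equation_iff)
    fix \<gamma> :: real assume "0 < \<gamma> \<and> beta_equation \<gamma>"
    then have "0 < \<gamma>" "sqrt_mean \<gamma> = sqrt_mean \<beta>" using b by (auto simp: beta_equation_iff)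
    then show "\<gamma> = \<beta>"
      using sqrt_mean_strict_mono[of \<beta> \<gamma>] sqrt_mean_strict_mono[of \<gamma> \<beta>] b(1)
      by (cases \<beta> \<gamma> rule: linorder_cases) auto
  qed
qed

lemma sqrt_mean_ge_third:
  assumes "beta_L \<le> \<beta>"
  shows "0 < \<beta>" "1/3 \<le> sqrt_mean \<beta>"
proof -
  have L: "0 < beta_L" "beta_equation beta_L"
    using theI'[OF beta_equation_ex1] unfolding beta_L_def by auto
  then show "0 < \<beta>" using assms by simp
  have "sqrt_mean beta_L = 1/3" using L beta_equation_iff by simp
  then show "1/3 \<le> sqrt_mean \<beta>"
    using sqrt_mean_strict_mono[OF L(1), of \<beta>] assms by fastforce
qed

section \<open>Averages along radii\<close>

lemma scaled_in_ball:
  fixes z :: complex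
  assumes "z \<in> ball 0 r" "0 \<le> s" "s \<le> 1"
  shows "z * of_real s \<in> ball 0 r"
proof -
  have "norm z * s \<le> norm z * 1" using assms by (intro mult_left_mono) auto
  then show ?thesis using assms by (simp add: norm_mult)
qed

lemma continuous_on_scaled:
  fixes h :: "complex \<Rightarrow> complex"
  assumes "continuous_on (ball 0 r) h" "\<beta> > 0" "z \<in> ball 0 r"
  shows "continuous_on {0..1} (\<lambda>t. h (z * of_real (t powr \<beta>)))"
  using assms scaled_in_ball[OF assms(3) powr_unit]
  by (intro continuous_on_compose2[OF assms(1)] continuous_intros continuous_on_powr_unit) auto

text \<open>
  The equation \<open>p + \<beta> z p' = h\<close> is solved by averaging \<open>h\<close> along a radius: the derivative of
  \<open>t p(z t\<^sup>\<beta>)\<close> with respect to \<open>t\<close> is \<open>h(z t\<^sup>\<beta>)\<close>. In particular the analytic solution is unique.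
\<close>

lemma has_integral_euler_operator:
  assumes \<beta>: "\<beta> > 0" and hol: "p holomorphic_on ball 0 r" and z: "z \<in> ball 0 r"
  defines "h \<equiv> \<lambda>w. p w + of_real \<beta> * (w * deriv p w)"
  shows "((\<lambda>t. h (z * of_real (t powr \<beta>))) has_integral p z) {0..1}"
proof -
  define F where "F = (\<lambda>t::real. of_real t * p (z * of_real (t powr \<beta>)))"
  have "((\<lambda>t. h (z * of_real (t powr \<beta>))) has_integral (F 1 - F 0)) {0..1}"
  proof (rule fundamental_theorem_of_calculus_interior)
    show "continuous_on {0..1} F"
      unfolding F_def
      by (intro continuous_intros continuous_on_scaled[OF _ \<beta> z]
          holomorphic_on_imp_continuous_on hol)
    fix t :: real assume t: "t \<in> {0<..<1}"
    define w where "w = z * of_real (t powr \<beta>)"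
    have w: "w \<in> ball 0 r"
      unfolding w_def using t \<beta> by (intro scaled_in_ball z powr_unit) auto
    have "((\<lambda>t. t powr \<beta>) has_real_derivative \<beta> * t powr (\<beta> - 1)) (at t)"
      using t by (auto intro!: derivative_eq_intros)
    then have "((\<lambda>t. complex_of_real (t powr \<beta>)) has_vector_derivative
        of_real (\<beta> * t powr (\<beta> - 1))) (at t)"
      by (intro has_vector_derivative_of_real) (simp add: has_real_derivative_iff_has_vector_derivative)
    then have 1: "((\<lambda>t. z * of_real (t powr \<beta>)) has_vector_derivative
        z * of_real (\<beta> * t powr (\<beta> - 1))) (at t)"
      by (rule has_vector_derivative_mult_right)
    have 2: "(p has_field_derivative deriv p w) (at (z * of_real (t powr \<beta>)))"
      using hol w unfolding w_def by (intro holomorphic_derivI[OF hol]) auto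
    have 3: "((\<lambda>t. complex_of_real t) has_vector_derivative of_real 1) (at t)"
      by (intro has_vector_derivative_of_real) (simp add: has_vector_derivative_id)
    have "(F has_vector_derivative
        of_real t * (z * of_real (\<beta> * t powr (\<beta> - 1)) * deriv p w) +
        of_real 1 * p w) (at t)"
      using has_vector_derivative_mult[OF 3 field_vector_diff_chain_at[OF 1 2]]
      unfolding F_def o_def w_def by simp
    also have "of_real t * (z * of_real (\<beta> * t powr (\<beta> - 1)) * deriv p w) =
        of_real (\<beta> * (t * t powr (\<beta> - 1))) * (z * deriv p w)" by simp
    also have "t * t powr (\<beta> - 1) = t powr \<beta>"
      using t by (simp add: powr_mult_base)
    finally show "(F has_vector_derivative h (z * of_real (t powr \<beta>))) (at t)"
      by (simp add: h_def w_def mult_ac add.commute)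
  qed simp
  then show ?thesis by (simp add: F_def)
qed

lemma holomorphic_power_average:
  assumes \<beta>: "\<beta> > 0" and hol: "h holomorphic_on ball 0 r"
  shows "(\<lambda>z. integral {0..1} (\<lambda>t. h (z * of_real (t powr \<beta>)))) holomorphic_on ball 0 r"
proof -
  have "(\<lambda>z. integral (cbox 0 1) (\<lambda>t. h (z * of_real (t powr \<beta>)))) holomorphic_on ball 0 r"
  proof (rule leibniz_rule_holomorphic)
    fix z :: complex and t :: real assume zt: "z \<in> ball 0 r" "t \<in> cbox 0 1"
    have "z * of_real (t powr \<beta>) \<in> ball 0 r"
      using zt \<beta> by (intro scaled_in_ball powr_unit) auto
    then have "(h has_field_derivative deriv h (z * of_real (t powr \<beta>))) (at (z * of_real (t powr \<beta>)))"
      using hol by (intro holomorphic_derivI[OF hol]) auto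
    then show "((\<lambda>z. h (z * of_real (t powr \<beta>))) has_field_derivative
        deriv h (z * of_real (t powr \<beta>)) * of_real (t powr \<beta>)) (at z within ball 0 r)"
      by (intro DERIV_chain2[where f = h and g = "\<lambda>z. z * of_real (t powr \<beta>)"])
         (auto intro!: derivative_eq_intros)
  next
    fix z :: complex assume "z \<in> ball 0 r"
    then show "(\<lambda>t. h (z * of_real (t powr \<beta>))) integrable_on cbox 0 1"
      unfolding box_real
      by (intro integrable_continuous_interval
          continuous_on_scaled[OF holomorphic_on_imp_continuous_on[OF hol] \<beta>])
  next
    have pc: "continuous_on (ball 0 r \<times> cbox (0::real) 1) (\<lambda>x::complex \<times> real. snd x powr \<beta>)"
      using \<beta> by (intro continuous_on_powr' continuous_intros) auto
    have "continuous_on (ball 0 r) (deriv h)"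
      using hol by (intro holomorphic_on_imp_continuous_on holomorphic_deriv) auto
    moreover have "continuous_on (ball 0 r \<times> cbox 0 1)
        (\<lambda>x::complex \<times> real. fst x * of_real (snd x powr \<beta>))"
      by (intro continuous_intros pc)
    moreover have "(\<lambda>x::complex \<times> real. fst x * of_real (snd x powr \<beta>)) ` (ball 0 r \<times> cbox 0 1)
        \<subseteq> ball 0 r"
    proof (rule image_subsetI)
      fix x :: "complex \<times> real" assume "x \<in> ball 0 r \<times> cbox 0 1"
      then show "fst x * of_real (snd x powr \<beta>) \<in> ball 0 r"
        by (intro scaled_in_ball powr_unit \<beta>) auto
    qed
    ultimately have "continuous_on (ball 0 r \<times> cbox 0 1)
        (\<lambda>x::complex \<times> real. deriv h (fst x * of_real (snd x powr \<beta>)))"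
      by (rule continuous_on_compose2)
    then show "continuous_on (ball 0 r \<times> cbox 0 1)
        (\<lambda>(z, t). deriv h (z * of_real (t powr \<beta>)) * of_real (t powr \<beta>))"
      unfolding case_prod_unfold by (intro continuous_on_mult continuous_on_of_real pc)
  qed simp
  then show ?thesis by simp
qed

section \<open>Averages of functions subordinate to the square root\<close>

text \<open>
  Only crude bounds are needed upwards and sideways; the lower bound is sharp: on each circle
  \<open>|w| = \<rho>\<close> the real part of \<open>(1 + w)\<^sup>1\<^sup>/\<^sup>2\<close> is smallest at \<open>w = -\<rho>\<close>.
\<close>

lemma csqrt_disc_bounds:
  assumes "norm w < 1"
  shows "sqrt (1 - norm w) \<le> Re (csqrt (1 + w))"
    and "Re (csqrt (1 + w)) \<le> 3/2" and "\<bar>Im (csqrt (1 + w))\<bar> \<le> 1"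
proof -
  have n: "1 - norm w \<le> norm (1 + w)" "norm (1 + w) \<le> 2"
    using norm_triangle_ineq2[of 1 "-w"] norm_triangle_ineq[of 1 w] assms by auto
  have R: "1 - norm w \<le> Re (1 + w)" "Re (1 + w) \<le> norm (1 + w)"
    using abs_Re_le_cmod[of w] complex_Re_le_cmod[of "1 + w"] by auto
  show "sqrt (1 - norm w) \<le> Re (csqrt (1 + w))"
    unfolding csqrt.sel using n R by (intro real_sqrt_le_mono) (simp add: field_simps)
  have "sqrt ((norm (1 + w) + Re (1 + w)) / 2) \<le> sqrt ((3/2)^2)"
    using n R by (intro real_sqrt_le_mono) (simp add: power2_eq_square)
  then show "Re (csqrt (1 + w)) \<le> 3/2" unfolding csqrt.sel by simp
  have "sqrt ((norm (1 + w) - Re (1 + w)) / 2) \<le> sqrt 1"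
    using n R assms by (intro real_sqrt_le_mono) (simp add: field_simps)
  moreover have "0 \<le> sqrt ((norm (1 + w) - Re (1 + w)) / 2)"
    using R by simp
  ultimately show "\<bar>Im (csqrt (1 + w))\<bar> \<le> 1"
    unfolding csqrt.sel by (simp add: abs_mult sgn_if)
qed

text \<open>
  Schwarz's lemma writes \<open>h(y) = (1 + w(y))\<^sup>1\<^sup>/\<^sup>2\<close> with \<open>|w(y)| \<le> |y|\<close>. Along a radius this bounds the real
  part of \<open>h\<close> below by \<open>(1 - |z| t\<^sup>\<beta>)\<^sup>1\<^sup>/\<^sup>2\<close>, and the average of this bound exceeds the mean of
  \<open>(1 - t\<^sup>\<beta>)\<^sup>1\<^sup>/\<^sup>2\<close> because \<open>|z| < 1\<close>. The other two bounds survive averaging because they cut out a convex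
  set.
\<close>

lemma subordinate_csqrt_average_bounds:
  assumes sub: "subordinate h (\<lambda>z. csqrt (1 + z))"
    and \<beta>: "\<beta> > 0" and z: "z \<in> unit_disc"
  defines "P \<equiv> integral {0..1} (\<lambda>t. h (z * of_real (t powr \<beta>)))"
  shows "sqrt_mean \<beta> < Re P" and "Re P \<le> 3/2" and "\<bar>Im P\<bar> \<le> 1"
proof -
  have hol: "h holomorphic_on unit_disc" and h0: "h 0 = 1"
    and range: "h ` unit_disc \<subseteq> (\<lambda>z. csqrt (1 + z)) ` unit_disc"
    using sub by (auto simp: subordinate_def analytic_imp_holomorphic)
  define w where "w = (\<lambda>z. h z ^ 2 - 1)"
  have h_eq: "h y = csqrt (1 + w y)" and w_lt: "norm (w y) < 1" if "norm y < 1" for y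
  proof -
    have "h y \<in> (\<lambda>z. csqrt (1 + z)) ` unit_disc" using range that by auto
    then obtain x where "norm x < 1" "h y = csqrt (1 + x)" by auto
    moreover from this have "w y = x" by (simp add: w_def)
    ultimately show "h y = csqrt (1 + w y)" "norm (w y) < 1" by auto
  qed
  have w_hol: "w holomorphic_on unit_disc"
    unfolding w_def by (intro holomorphic_intros hol)
  have schwarz: "norm (w y) \<le> norm y" if "norm y < 1" for y
    by (rule Schwarz_Lemma(1)[OF w_hol _ w_lt that]) (simp_all add: w_def h0)
  define g where "g = (\<lambda>t. h (z * of_real (t powr \<beta>)))"
  have in_disc: "norm (z * of_real (t powr \<beta>)) < 1" if "t \<in> {0..1}" for t
    using scaled_in_ball[OF z powr_unit[of t \<beta>]] that \<beta> by auto
  have g_cont: "continuous_on {0..1} g"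
    unfolding g_def by (intro continuous_on_scaled[OF _ \<beta> z] holomorphic_on_imp_continuous_on hol)
  have g_int: "(g has_integral P) {0..1}"
    unfolding P_def g_def[symmetric]
    by (intro integrable_integral integrable_continuous_interval g_cont)
  then have Re_int: "((\<lambda>t. Re (g t)) has_integral Re P) {0..1}"
    and Im_int: "((\<lambda>t. Im (g t)) has_integral Im P) {0..1}"
    by (rule has_integral_Re, rule has_integral_Im)
  have const: "((\<lambda>t. c) has_integral c) {0..1::real}" for c :: real
    using has_integral_const_real[of c 0 1] by simp
  have bounds: "sqrt (1 - norm z * t powr \<beta>) \<le> Re (g t)" "Re (g t) \<le> 3/2" "\<bar>Im (g t)\<bar> \<le> 1"
    if t: "t \<in> {0..1}" for t
  proof -
    define y where "y = z * of_real (t powr \<beta>)"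
    have y: "norm y < 1" using in_disc[OF t] by (simp add: y_def)
    have gt: "g t = csqrt (1 + w y)" using h_eq[OF y] by (simp add: g_def y_def)
    have "sqrt (1 - norm z * t powr \<beta>) \<le> sqrt (1 - norm (w y))"
      using schwarz[OF y] by (intro real_sqrt_le_mono) (simp add: y_def norm_mult)
    then show "sqrt (1 - norm z * t powr \<beta>) \<le> Re (g t)" "Re (g t) \<le> 3/2" "\<bar>Im (g t)\<bar> \<le> 1"
      using csqrt_disc_bounds[OF w_lt[OF y]] by (auto simp: gt)
  qed
  have cont: "continuous_on {0..1} (\<lambda>t. sqrt (1 - c * t powr \<beta>))" for c
    by (intro continuous_intros continuous_on_powr_unit \<beta>)
  have "sqrt_mean \<beta> < integral {0..1} (\<lambda>t. sqrt (1 - norm z * t powr \<beta>))"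
    unfolding sqrt_mean_def
  proof (rule integral_less_real)
    fix t :: real assume "t \<in> {0<..<1}"
    then show "sqrt (1 - t powr \<beta>) < sqrt (1 - norm z * t powr \<beta>)"
      using z by simp
  qed (use cont cont[of 1] in simp_all)
  also have "\<dots> \<le> Re P"
    using has_integral_le[OF integrable_integral[OF integrable_continuous_interval[OF cont]] Re_int]
      bounds(1) by blast
  finally show "sqrt_mean \<beta> < Re P" .
  show "Re P \<le> 3/2" using has_integral_le[OF Re_int const] bounds(2) by blast
  have "Im P \<le> 1" using bounds(3) by (intro has_integral_le[OF Im_int const]) (auto simp: abs_le_iff)
  moreover have "-1 \<le> Im P"
    using bounds(3) by (intro has_integral_le[OF const Im_int]) (auto simp: abs_le_iff minus_le_iff)
  ultimately show "\<bar>Im P\<bar> \<le> 1" by linarith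
qed

section \<open>The quotient \<open>z f' / f\<close>\<close>

text \<open>
  Near the origin neither \<open>f / z\<close> nor \<open>f'\<close> vanishes, so \<open>p = z f' / f\<close> extends analytically, and
  \<open>1 - z f' / f + z f'' / f'\<close> is \<open>z p' / p\<close>, the logarithmic derivative of \<open>p\<close> times \<open>z\<close>.
\<close>

lemma class_A_log_derivative_near_0:
  assumes f: "f \<in> class_A"
  obtains r p where "0 < r" "r \<le> 1" "p holomorphic_on ball 0 r" "p 0 = 1"
    "\<And>z. z \<in> ball 0 r - {0} \<Longrightarrow> f z \<noteq> 0"
    "\<And>z. z \<in> ball 0 r - {0} \<Longrightarrow> z * deriv f z / f z = p z"
    "\<And>z. z \<in> ball 0 r - {0} \<Longrightarrow> G_fun f z * p z = z * deriv p z"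
proof -
  have hol: "f holomorphic_on unit_disc" and f0: "f 0 = 0" and d0: "deriv f 0 = 1"
    using f by (auto simp: class_A_def analytic_imp_holomorphic)
  define g where "g = (\<lambda>z. if z = 0 then deriv f 0 else f z / z)"
  have g_hol: "g holomorphic_on unit_disc"
    by (rule pole_theorem_open_0[OF hol, of 0]) (auto simp: g_def f0)
  have d_hol: "deriv f holomorphic_on unit_disc" using hol by (intro holomorphic_deriv) auto
  have "\<forall>\<^sub>F z in nhds 0. g z \<noteq> 0 \<and> deriv f z \<noteq> 0 \<and> z \<in> unit_disc"
  proof (intro eventually_conj)
    have *: "isCont g 0" "isCont (deriv f) 0"
      using g_hol d_hol
      by (auto intro!: continuous_on_interior[of unit_disc] holomorphic_on_imp_continuous_on)
    show "\<forall>\<^sub>F z in nhds 0. g z \<noteq> 0"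
      using *(1) by (rule isCont_tendsto_compose[THEN tendsto_imp_eventually_ne, of 0 g])
        (auto simp: filterlim_ident g_def d0)
    show "\<forall>\<^sub>F z in nhds 0. deriv f z \<noteq> 0"
      using *(2) by (rule isCont_tendsto_compose[THEN tendsto_imp_eventually_ne, of 0 "deriv f"])
        (auto simp: filterlim_ident d0)
    show "\<forall>\<^sub>F z::complex in nhds 0. z \<in> unit_disc"
      by (intro eventually_nhds_in_open) auto
  qed
  then obtain r where r: "r > 0"
    and nz: "\<And>z. dist z 0 < r \<Longrightarrow> g z \<noteq> 0 \<and> deriv f z \<noteq> 0 \<and> z \<in> unit_disc"
    unfolding eventually_nhds_metric by blast
  define p where "p = (\<lambda>z. deriv f z / g z)"
  have sub: "ball 0 r \<subseteq> unit_disc" using nz by (auto simp: dist_commute)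
  have "r \<le> 1" using sub r by (subst (asm) ball_subset_ball_iff) auto
  have p_hol: "p holomorphic_on ball 0 r"
    unfolding p_def using nz
    by (intro holomorphic_intros holomorphic_on_subset[OF d_hol sub]
        holomorphic_on_subset[OF g_hol sub]) (auto simp: dist_commute)
  have fnz: "f z \<noteq> 0" if "z \<in> ball 0 r - {0}" for z
    using nz[of z] that by (auto simp: g_def dist_commute split: if_splits)
  have eq: "z * deriv f z / f z = p z" if "z \<in> ball 0 r - {0}" for z
    using that by (auto simp: p_def g_def)
  have "G_fun f z * p z = z * deriv p z" if z: "z \<in> ball 0 r - {0}" for z
  proof -
    have zd: "z \<in> unit_disc" using z sub by auto
    have f1: "(f has_field_derivative deriv f z) (at z)"
      using zd by (intro holomorphic_derivI[OF hol]) auto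
    have f2: "(deriv f has_field_derivative deriv (deriv f) z) (at z)"
      using zd by (intro holomorphic_derivI[OF d_hol]) auto
    have n: "f z \<noteq> 0" "deriv f z \<noteq> 0" "z \<noteq> 0" using fnz[OF z] nz[of z] z by (auto simp: dist_commute)
    have "((\<lambda>z. z * deriv f z / f z) has_field_derivative
        ((deriv f z + z * deriv (deriv f) z) * f z - z * deriv f z * deriv f z) / (f z * f z)) (at z)"
      using n by (auto intro!: derivative_eq_intros f1 f2 simp: algebra_simps)
    then have "(p has_field_derivative
        ((deriv f z + z * deriv (deriv f) z) * f z - z * deriv f z * deriv f z) / (f z * f z)) (at z)"
      by (rule has_field_derivative_transform_within_open[of _ _ _ "ball 0 r - {0}"])
         (use z eq in auto)
    then have d: "deriv p z =
        ((deriv f z + z * deriv (deriv f) z) * f z - z * deriv f z * deriv f z) / (f z * f z)"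
      by (rule DERIV_imp_deriv)
    show ?thesis
      unfolding eq[OF z, symmetric] d G_fun_def using n by (simp add: field_simps)
  qed
  with r \<open>r \<le> 1\<close> p_hol fnz eq show thesis
    by (intro that[of r p]) (auto simp: p_def g_def d0)
qed

text \<open>
  Away from the origin \<open>f\<close> and \<open>f'\<close> might vanish, so \<open>z f' / f\<close> cannot be handled directly. The average
  \<open>P\<close> of \<open>h\<close> is analytic in the whole disc and equals \<open>z f' / f\<close> near the origin, so the identity
  \<open>z f' = P f\<close> between analytic functions spreads from there to the disc. As the zeros of \<open>f\<close> are
  isolated, \<open>P\<close> is the limit of \<open>z f' / f\<close> at every point.
\<close>

lemma class_A_log_derivative_eq_average:
  assumes f: "f \<in> class_A" and \<beta>: "\<beta> > 0"
    and h_def: "h = remove_sings (\<lambda>z. (1 + of_real \<beta> * G_fun f z) * (z * deriv f z / f z))"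
    and h_hol: "h holomorphic_on unit_disc" and h0: "h 0 = 1"
    and z: "z \<in> unit_disc"
  shows "remove_sings (\<lambda>z. z * deriv f z / f z) z =
    integral {0..1} (\<lambda>t. h (z * of_real (t powr \<beta>)))"
proof -
  define P where "P = (\<lambda>z. integral {0..1} (\<lambda>t. h (z * of_real (t powr \<beta>))))"
  have P_hol: "P holomorphic_on unit_disc"
    unfolding P_def by (rule holomorphic_power_average[OF \<beta> h_hol])
  have hol: "f holomorphic_on unit_disc" and f0: "f 0 = 0" and d0: "deriv f 0 = 1"
    using f by (auto simp: class_A_def analytic_imp_holomorphic)
  have d_hol: "deriv f holomorphic_on unit_disc" using hol by (intro holomorphic_deriv) auto
  obtain r p where r: "0 < r" "r \<le> 1" and p_hol: "p holomorphic_on ball 0 r" and p0: "p 0 = 1"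
    and fnz: "\<And>z. z \<in> ball 0 r - {0} \<Longrightarrow> f z \<noteq> 0"
    and p_eq: "\<And>z. z \<in> ball 0 r - {0} \<Longrightarrow> z * deriv f z / f z = p z"
    and G_eq: "\<And>z. z \<in> ball 0 r - {0} \<Longrightarrow> G_fun f z * p z = z * deriv p z"
    using class_A_log_derivative_near_0[OF f] by metis
  define q where "q = (\<lambda>w. p w + of_real \<beta> * (w * deriv p w))"
  have q_hol: "q holomorphic_on ball 0 r"
    unfolding q_def by (intro holomorphic_intros p_hol holomorphic_deriv) auto
  have h_eq: "h w = q w" if w: "w \<in> ball 0 r" for w
  proof (cases "w = 0")
    case False
    have "\<forall>\<^sub>F y in at w. y \<in> ball 0 r - {0}"
      using w False by (intro eventually_at_in_open') auto
    then have "\<forall>\<^sub>F y in at w. q y = (1 + of_real \<beta> * G_fun f y) * (y * deriv f y / f y)"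
    proof eventually_elim
      case (elim y)
      show ?case unfolding p_eq[OF elim] q_def using G_eq[OF elim] by (simp add: algebra_simps)
    qed
    moreover have "q \<midarrow>w\<rightarrow> q w"
      using q_hol w by (metis analytic_at_imp_isCont analytic_on_open analytic_on_subset
        empty_subsetI insert_subset isContD open_ball)
    ultimately show ?thesis
      unfolding h_def by (intro remove_sings_eqI) (rule Lim_transform_eventually)
  qed (simp add: q_def p0 h0)
  have p_P: "p w = P w" if w: "w \<in> ball 0 r" for w
  proof -
    have "((\<lambda>t. q (w * of_real (t powr \<beta>))) has_integral p w) {0..1}"
      using has_integral_euler_operator[OF \<beta> p_hol w] unfolding q_def .
    then have "((\<lambda>t. h (w * of_real (t powr \<beta>))) has_integral p w) {0..1}"
      by (rule has_integral_eq[rotated])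
         (use scaled_in_ball[OF w powr_unit] \<beta> in \<open>auto simp: h_eq\<close>)
    then show ?thesis unfolding P_def by (simp add: integral_unique)
  qed
  have ode: "w * deriv f w = P w * f w" if "w \<in> unit_disc" for w
  proof (rule analytic_continuation_open[of "ball 0 r" unit_disc "\<lambda>w. w * deriv f w" "\<lambda>w. P w * f w"])
    show "y * deriv f y = P y * f y" if "y \<in> ball 0 r" for y
      using p_eq[of y] p_P[of y] fnz[of y] that f0 by (cases "y = 0") (auto simp: field_simps)
  qed (use r that in \<open>auto intro!: holomorphic_intros P_hol hol d_hol\<close>)
  have "f (of_real (r/2)) \<noteq> 0" using fnz[of "of_real (r/2)"] r by auto
  then have "\<forall>\<^sub>F w in at z. f w \<noteq> 0 \<and> w \<in> unit_disc"
    using r z by (intro non_zero_neighbour_alt[OF hol, of z "of_real (r/2)"]) auto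
  then have "\<forall>\<^sub>F w in at z. P w = w * deriv f w / f w"
    by eventually_elim (simp add: ode)
  moreover have "P \<midarrow>z\<rightarrow> P z"
    using P_hol z by (metis analytic_at_imp_isCont analytic_on_open analytic_on_subset
      empty_subsetI insert_subset isContD open_ball)
  ultimately have "remove_sings (\<lambda>z. z * deriv f z / f z) z = P z"
    by (intro remove_sings_eqI) (rule Lim_transform_eventually)
  then show ?thesis by (simp add: P_def)
qed

theorem corollary3p1:
  shows "(\<exists>!\<beta>::real. 0 < \<beta> \<and> beta_equation \<beta>) \<and>
    (\<forall>(\<beta>::real) (f::complex \<Rightarrow> complex).
       beta_L \<le> \<beta> \<longrightarrow> f \<in> class_A \<longrightarrow>
       subordinate
         (remove_sings (\<lambda>z. (1 + of_real \<beta> * G_fun f z) * (z * deriv f z / f z)))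
         (\<lambda>z. csqrt (1 + z)) \<longrightarrow>
       f \<in> S_Ne)"
proof (intro conjI allI impI)
  show "\<exists>!\<beta>::real. 0 < \<beta> \<and> beta_equation \<beta>" by (rule beta_equation_ex1)
next
  fix \<beta> :: real and f :: "complex \<Rightarrow> complex"
  define h where
    "h = remove_sings (\<lambda>z. (1 + of_real \<beta> * G_fun f z) * (z * deriv f z / f z))"
  assume "beta_L \<le> \<beta>" and f: "f \<in> class_A"
    and "subordinate
         (remove_sings (\<lambda>z. (1 + of_real \<beta> * G_fun f z) * (z * deriv f z / f z)))
         (\<lambda>z. csqrt (1 + z))"
  then have sub: "subordinate h (\<lambda>z. csqrt (1 + z))" by (simp only: h_def)
  have \<beta>: "0 < \<beta>" and third: "1/3 \<le> sqrt_mean \<beta>" using sqrt_mean_ge_third \<open>beta_L \<le> \<beta>\<close> by auto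
  have h_hol: "h holomorphic_on unit_disc" and h0: "h 0 = 1"
    using sub by (auto simp: subordinate_def analytic_imp_holomorphic)
  define P where "P = (\<lambda>z. integral {0..1} (\<lambda>t. h (z * of_real (t powr \<beta>))))"
  have P_hol: "P holomorphic_on unit_disc"
    unfolding P_def by (rule holomorphic_power_average[OF \<beta> h_hol])
  have P0: "P 0 = 1" by (simp add: P_def h0)
  define L where "L = remove_sings (\<lambda>z. z * deriv f z / f z)"
  have L_eq: "L z = P z" if "z \<in> unit_disc" for z
    unfolding L_def P_def
    by (rule class_A_log_derivative_eq_average[OF f \<beta> h_def h_hol h0 that])
  have "L holomorphic_on unit_disc"
    using P_hol by (rule holomorphic_transform) (simp add: L_eq)
  moreover have "L z \<in> phi_Ne ` unit_disc" if "z \<in> unit_disc" for z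
  proof (rule rectangle_subset_phi_Ne)
    note bounds = subordinate_csqrt_average_bounds[OF sub \<beta> that]
    show "\<bar>Re (L z) - 1\<bar> < 2/3"
      using bounds(1,2) third unfolding L_eq[OF that] P_def by linarith
    show "\<bar>Im (L z)\<bar> \<le> 1"
      using bounds(3) unfolding L_eq[OF that] P_def .
  qed
  ultimately have "subordinate L phi_Ne"
    using L_eq[of 0] P0 univalent_phi_Ne
    by (auto simp: subordinate_def analytic_on_open phi_Ne_def)
  then show "f \<in> S_Ne" using f by (simp add: S_Ne_def L_def)
qed

end
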